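(* Let $k\ge0$, and let $$H^{(k)}(q,u,v,x)=\sum_{r,i,j,n\ge0}|\{\pi\in\mathcal{I}^{(k)}_n : \operatorname{inv}(\pi)=r,\ \operatorname{fp}(\pi)=i,\ \operatorname{exc}(\pi)=j\}|\; q^r u^i v^j x^n.$$ Then $H^{(k)}(q,u,v,x)$ equals the finite continued fraction $$\cfrac{1}{1-ux-\cfrac{vqx^2}{1-uq^2x-\cfrac{vq^3(1+q^2)x^2}{\ddots\; 1-uq^{2k-2}x-\cfrac{vq^{2k-1}(1+q^2+q^4+\dots+q^{2k-2})x^2}{1-uq^{2k}x}}}}.$$ That is, $H^{(k)}=1/C_0$, where $C_k=1-uq^{2k}x$ and $C_h=1-uq^{2h}x-\dfrac{vq^{2h+1}(1+q^2+q^4+\dots+q^{2h})x^2}{C_{h+1}}$ for $0\le h<k$.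
   Context: $\mathcal{S}_n$ is the set of permutations of $\{1,\dots,n\}$. For $k\ge0$, $$\mathcal{A}^{(k)}_n=\{\pi\in\mathcal{S}_n : |\{j : j\le i\text{ and }\pi(j)>i\}|\le k\text{ for every } i\in\{1,\dots,n\}\},$$ and $\mathcal{I}^{(k)}_n=\{\pi\in\mathcal{A}^{(k)}_n : \pi=\pi^{-1}\}$, where for $n=0$ these sets consist of the empty permutation only, contributing $1$ to the generating function. For $\pi\in\mathcal{S}_n$, $\operatorname{inv}(\pi)$ is the number of pairs $(i,j)$ with $i<j$ and $\pi(i)>\pi(j)$, $\operatorname{fp}(\pi)$ is the number of $i$ with $\pi(i)=i$, and $\operatorname{exc}(\pi)$ is the number of $i$ with $\pi(i)>i$. The identity is one of formal power series in $x$ with coefficients polynomials in $q,u,v$. *)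

theory Defs
  imports
    "HOL-Combinatorics.Permutations"
    "HOL-Computational_Algebra.Computational_Algebra"
    "HOL-Library.Groups_Big_Fun"
begin

text \<open>
  An element of \<open>S\<^sub>n\<close> is a function \<open>\<pi> :: nat \<Rightarrow> nat\<close> with \<open>\<pi> permutes {1..n}\<close>; in particular
  it is the identity outside \<open>{1..n}\<close>, so that the only permutation of \<open>{1..0} = {}\<close> is \<open>id\<close>.
\<close>

definition bounded_perms :: "nat \<Rightarrow> nat \<Rightarrow> (nat \<Rightarrow> nat) set" where
  "bounded_perms k n =
     {\<pi>. \<pi> permutes {1..n} \<and> (\<forall>i\<in>{1..n}. card {j \<in> {1..n}. j \<le> i \<and> \<pi> j > i} \<le> k)}"

definition bounded_involutions :: "nat \<Rightarrow> nat \<Rightarrow> (nat \<Rightarrow> nat) set" where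
  "bounded_involutions k n = {\<pi> \<in> bounded_perms k n. \<pi> = inv \<pi>}"

definition inversions :: "nat \<Rightarrow> (nat \<Rightarrow> nat) \<Rightarrow> nat" where
  "inversions n \<pi> = card {(i, j). i \<in> {1..n} \<and> j \<in> {1..n} \<and> i < j \<and> \<pi> i > \<pi> j}"

definition fixed_points :: "nat \<Rightarrow> (nat \<Rightarrow> nat) \<Rightarrow> nat" where
  "fixed_points n \<pi> = card {i \<in> {1..n}. \<pi> i = i}"

definition excedances :: "nat \<Rightarrow> (nat \<Rightarrow> nat) \<Rightarrow> nat" where
  "excedances n \<pi> = card {i \<in> {1..n}. \<pi> i > i}"

text \<open>
  The ring \<open>\<int>[q,u,v]\<close> is represented as \<open>((\<int>[v])[u])[q]\<close>; the power series variable \<open>x\<close>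
  is \<^const>\<open>fps_X\<close>.
\<close>

type_synonym coeff_ring = "int poly poly poly"

definition q :: coeff_ring where "q = [:0, 1:]"
definition u :: coeff_ring where "u = [:[:0, 1:]:]"
definition v :: coeff_ring where "v = [:[:[:0, 1:]:]:]"

lemma monomial_eq: "of_nat c * q ^ r * u ^ i * v ^ j = monom (monom (monom (int c) j) i) r"
proof -
  have c: "(of_nat c :: coeff_ring) = [:[:[:int c:]:]:]"
    by (simp add: of_nat_poly)
  have q: "q ^ r = monom 1 r"
    by (simp add: q_def monom_altdef)
  have u: "u ^ i = [:monom 1 i:]"
    by (simp add: u_def monom_altdef poly_const_pow)
  have v: "v ^ j = [:[:monom 1 j:]:]"
    by (simp add: v_def monom_altdef poly_const_pow)
  show ?thesis
    by (simp add: c q u v smult_monom mult.commute)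
qed

text \<open>
  For fixed \<open>n\<close> only finitely many triples \<open>(r, i, j)\<close> contribute, see \<open>involution_gf_nth\<close> below,
  so \<^const>\<open>Sum_any\<close> (which would be \<open>0\<close> for an infinite support) is the sum over all triples.
\<close>

definition involution_gf :: "nat \<Rightarrow> coeff_ring fps" where
  "involution_gf k = Abs_fps (\<lambda>n. Sum_any (\<lambda>(r, i, j).
     of_nat (card {\<pi> \<in> bounded_involutions k n.
                     inversions n \<pi> = r \<and> fixed_points n \<pi> = i \<and> excedances n \<pi> = j})
       * q ^ r * u ^ i * v ^ j))"

lemma finite_bounded_involutions: "finite (bounded_involutions k n)"
  by (rule finite_subset[OF _ finite_permutations[of "{1..n}"]])
     (auto simp: bounded_involutions_def bounded_perms_def)

lemma involution_gf_nth:
  "poly.coeff (poly.coeff (poly.coeff (fps_nth (involution_gf k) n) r) i) j =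
     int (card {\<pi> \<in> bounded_involutions k n.
                  inversions n \<pi> = r \<and> fixed_points n \<pi> = i \<and> excedances n \<pi> = j})"
proof -
  define N where "N = (\<lambda>r i j. card {\<pi> \<in> bounded_involutions k n.
    inversions n \<pi> = r \<and> fixed_points n \<pi> = i \<and> excedances n \<pi> = j})"
  define F :: "nat \<times> nat \<times> nat \<Rightarrow> coeff_ring" where
    "F = (\<lambda>(r, i, j). of_nat (N r i j) * q ^ r * u ^ i * v ^ j)"
  define T where "T = insert (r, i, j)
    ((\<lambda>\<pi>. (inversions n \<pi>, fixed_points n \<pi>, excedances n \<pi>)) ` bounded_involutions k n)"
  have fin: "finite T"
    by (simp add: T_def finite_bounded_involutions)
  have sub: "{t. F t \<noteq> 0} \<subseteq> T"
  proof clarify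
    fix r' i' j' assume "F (r', i', j') \<noteq> 0"
    then have "N r' i' j' \<noteq> 0"
      by (auto simp: F_def)
    then have "{\<pi> \<in> bounded_involutions k n. inversions n \<pi> = r' \<and> fixed_points n \<pi> = i' \<and>
        excedances n \<pi> = j'} \<noteq> {}"
      unfolding N_def by (metis card.empty)
    then show "(r', i', j') \<in> T"
      unfolding T_def by auto
  qed
  have "fps_nth (involution_gf k) n = Sum_any F"
    by (simp add: involution_gf_def F_def N_def)
  also have "\<dots> = sum F T"
    by (rule Sum_any.expand_superset[OF fin sub])
  finally have *: "fps_nth (involution_gf k) n = sum F T" .
  have "poly.coeff (poly.coeff (poly.coeff (F t) r) i) j =
      (if t = (r, i, j) then int (N r i j) else 0)" for t
    by (cases t) (auto simp: F_def monomial_eq)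
  then have "poly.coeff (poly.coeff (poly.coeff (fps_nth (involution_gf k) n) r) i) j =
      int (N r i j)"
    using fin by (simp add: * coeff_sum T_def)
  then show ?thesis
    by (simp only: N_def)
qed

text \<open>
  The reciprocal of a power series with constant coefficient \<open>1\<close>. The library's division on
  \<^typ>\<open>'a fps\<close> is not available here, since the coefficient ring is not a field.
\<close>

definition fps_recip :: "'a::comm_ring_1 fps \<Rightarrow> 'a fps" where
  "fps_recip f = fps_right_inverse f 1"

lemma fps_recip: "fps_nth f 0 = 1 \<Longrightarrow> f * fps_recip f = 1"
  unfolding fps_recip_def by (rule fps_right_inverse) simp

text \<open>
  \<open>cf_denom k h\<close> is the denominator at level \<open>h \<le> k\<close> of the finite continued fraction; the whole
  fraction is the reciprocal of \<open>cf_denom k 0\<close>.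
\<close>

function cf_denom :: "nat \<Rightarrow> nat \<Rightarrow> coeff_ring fps" where
  "cf_denom k h =
     1 - fps_const (u * q ^ (2 * h)) * fps_X
       - (if h < k
          then fps_const (v * q ^ (2 * h + 1) * (\<Sum>l\<le>h. q ^ (2 * l))) * fps_X ^ 2
                 * fps_recip (cf_denom k (h + 1))
          else 0)"
  by pat_completeness auto
termination by (relation "measure (\<lambda>(k, h). k - h)") auto

declare cf_denom.simps [simp del]

lemma cf_denom_nth_0: "fps_nth (cf_denom k h) 0 = 1"
  by (subst cf_denom.simps) simp

end

theory Submission
  imports Defs
begin

text \<open>
  Read an involution from left to right, recording after each position the number \<open>h\<close> of arcs
  \<open>i < \<pi> i\<close> that have been opened but not yet closed. A fixed point below \<open>h\<close> open arcs forms two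
  inversions with each of them. Closing one of \<open>h + 1\<close> open arcs gives one inversion for the arc
  itself, four for each other open arc that started earlier (nesting) and two for each that started
  later (crossing), hence \<open>q\<^sup>2\<^sup>h\<^sup>+\<^sup>1 (1 + q\<^sup>2 + \<dots> + q\<^sup>2\<^sup>h)\<close> after summing over the closed arc.
  So the generating functions \<open>F\<^sub>h\<close> of prefixes with \<open>h\<close> open arcs satisfy a linear three-term
  recurrence in \<open>h\<close>, and eliminating from \<open>h = k\<close> downwards gives \<open>C\<^sub>h F\<^sub>h = x F\<^sub>h\<^sub>-\<^sub>1\<close> and
  \<open>C\<^sub>0 F\<^sub>0 = 1\<close>.
\<close>

definition open_arcs :: "nat \<Rightarrow> (nat \<Rightarrow> nat) \<Rightarrow> nat set" where
  "open_arcs n f = {i \<in> {1..n}. f i = 0}"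

text \<open>
  The restriction of an involution to \<open>{1..n}\<close>, where the value \<open>0\<close> stands for a partner beyond \<open>n\<close>.
\<close>

definition partial_involutions :: "nat \<Rightarrow> nat \<Rightarrow> (nat \<Rightarrow> nat) set" where
  "partial_involutions k n =
     {f. (\<forall>i. i \<notin> {1..n} \<longrightarrow> f i = i) \<and> (\<forall>i\<in>{1..n}. f i \<le> n \<and> (f i \<noteq> 0 \<longrightarrow> f (f i) = i))
       \<and> (\<forall>m\<in>{1..n}. card {j \<in> {1..m}. f j = 0 \<or> f j > m} \<le> k)}"

definition open_involutions :: "nat \<Rightarrow> nat \<Rightarrow> nat \<Rightarrow> (nat \<Rightarrow> nat) set" where
  "open_involutions k n h = {f \<in> partial_involutions k n. card (open_arcs n f) = h}"

definition closed_pairs :: "nat \<Rightarrow> (nat \<Rightarrow> nat) \<Rightarrow> (nat \<times> nat) set" where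
  "closed_pairs n f = {(i, j). i \<in> {1..n} \<and> j \<in> {1..n} \<and> i < j \<and> 0 < f j \<and> f j < f i}"

definition open_pairs :: "nat \<Rightarrow> (nat \<Rightarrow> nat) \<Rightarrow> (nat \<times> nat) set" where
  "open_pairs n f = {(i, j). i \<in> {1..n} \<and> j \<in> {1..n} \<and> i < j \<and> f i = 0 \<and> 0 < f j}"

text \<open>
  An open arc at \<open>i\<close> and a closed position \<open>j > i\<close> will give two inversions of the completed
  involution: \<open>(i, j)\<close> itself, and \<open>(f j, p)\<close> with values \<open>j > i\<close>,
  where \<open>p > n\<close> is the future partner of \<open>i\<close>.
\<close>

definition partial_inversions :: "nat \<Rightarrow> (nat \<Rightarrow> nat) \<Rightarrow> nat" where
  "partial_inversions n f = card (closed_pairs n f) + 2 * card (open_pairs n f)"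

definition weight :: "nat \<Rightarrow> (nat \<Rightarrow> nat) \<Rightarrow> coeff_ring" where
  "weight n f = q ^ partial_inversions n f * u ^ fixed_points n f * v ^ excedances n f"

definition open_weight :: "nat \<Rightarrow> nat \<Rightarrow> nat \<Rightarrow> coeff_ring" where
  "open_weight k n h = sum (weight n) (open_involutions k n h)"

lemma finite_pairs [simp]: "finite (closed_pairs n f)" "finite (open_pairs n f)"
  by (rule finite_subset[of _ "{1..n} \<times> {1..n}"]; auto simp: closed_pairs_def open_pairs_def)+

lemma finite_open_arcs [simp]: "finite (open_arcs n f)"
  by (simp add: open_arcs_def)

lemma atLeast1_atMost_Suc: "{1..Suc n} = insert (Suc n) {1..n}"
  by auto

lemma partial_involutionsD:
  assumes "f \<in> partial_involutions k n"
  shows "i \<notin> {1..n} \<Longrightarrow> f i = i" "i \<in> {1..n} \<Longrightarrow> f i \<le> n"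
    "i \<in> {1..n} \<Longrightarrow> f i \<noteq> 0 \<Longrightarrow> f (f i) = i"
  using assms by (auto simp: partial_involutions_def)

lemma partial_involutions_le:
  assumes "f \<in> partial_involutions k n" "i \<le> n"
  shows "f i \<le> n"
  using assms by (cases "i = 0") (auto simp: partial_involutions_def)

lemma finite_partial_involutions: "finite (partial_involutions k n)"
proof -
  have "partial_involutions k n \<subseteq>
      {f. (\<forall>i. (i \<in> {1..n} \<longrightarrow> f i \<in> {0..n}) \<and> (i \<notin> {1..n} \<longrightarrow> f i = i))}"
    by (auto simp: partial_involutions_def)
  moreover have "inj_on (\<lambda>f i. if i \<in> {1..n} then f i else undefined)
      {f::nat\<Rightarrow>nat. (\<forall>i. (i \<in> {1..n} \<longrightarrow> f i \<in> {0..n}) \<and> (i \<notin> {1..n} \<longrightarrow> f i = i))}"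
    by (rule inj_onI) (simp add: fun_eq_iff; metis)
  moreover have "(\<lambda>f i. if i \<in> {1..n} then f i else undefined) `
      {f::nat\<Rightarrow>nat. (\<forall>i. (i \<in> {1..n} \<longrightarrow> f i \<in> {0..n}) \<and> (i \<notin> {1..n} \<longrightarrow> f i = i))}
      \<subseteq> (\<Pi>\<^sub>E i\<in>{1..n}. {0..n})"
    by (auto simp: PiE_def extensional_def)
  ultimately show ?thesis
    by (meson finite_PiE finite_atLeastAtMost finite_imageD finite_subset)
qed

lemma finite_open_involutions [simp]: "finite (open_involutions k n h)"
  by (simp add: open_involutions_def finite_partial_involutions)

lemma open_weight_0: "open_weight k 0 h = (if h = 0 then 1 else 0)"
proof -
  have "open_involutions k 0 h = (if h = 0 then {id} else {})"
    by (auto simp: open_involutions_def partial_involutions_def open_arcs_def fun_eq_iff)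
  moreover have "weight 0 f = 1" for f
    by (simp add: weight_def partial_inversions_def closed_pairs_def open_pairs_def
        fixed_points_def excedances_def)
  ultimately show ?thesis
    by (simp add: open_weight_def)
qed

lemma open_weight_eq_0:
  assumes "h > k"
  shows "open_weight k n h = 0"
proof (cases "n = 0")
  case False
  have "open_involutions k n h = {}"
  proof (rule ccontr)
    assume "open_involutions k n h \<noteq> {}"
    then obtain f where f: "f \<in> partial_involutions k n" "card (open_arcs n f) = h"
      by (auto simp: open_involutions_def)
    have "{j \<in> {1..n}. f j = 0 \<or> f j > n} = open_arcs n f"
      using partial_involutionsD(2)[OF f(1)] by (fastforce simp: open_arcs_def)
    moreover have "card {j \<in> {1..n}. f j = 0 \<or> f j > n} \<le> k"
      using f(1) False by (auto simp: partial_involutions_def)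
    ultimately show False
      using f(2) assms by simp
  qed
  then show ?thesis
    by (simp add: open_weight_def)
qed (use assms in \<open>simp add: open_weight_0\<close>)

subsection \<open>Appending a position\<close>

lemma partial_involutions_Suc_iff:
  assumes "\<And>i. i \<notin> {1..Suc n} \<Longrightarrow> g i = i"
    and "\<And>i. i \<in> {1..Suc n} \<Longrightarrow> g i \<le> Suc n \<and> (g i \<noteq> 0 \<longrightarrow> g (g i) = i)"
    and "\<And>i. i \<notin> {1..n} \<Longrightarrow> f i = i"
    and "\<And>i. i \<in> {1..n} \<Longrightarrow> f i \<le> n \<and> (f i \<noteq> 0 \<longrightarrow> f (f i) = i)"
    and fg: "\<And>i. i \<in> {1..n} \<Longrightarrow> f i = (if g i = Suc n then 0 else g i)"
  shows "g \<in> partial_involutions k (Suc n) \<longleftrightarrow>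
    f \<in> partial_involutions k n \<and> card (open_arcs (Suc n) g) \<le> k"
proof -
  have g: "g \<in> partial_involutions k (Suc n) \<longleftrightarrow>
      (\<forall>m\<in>{1..Suc n}. card {j \<in> {1..m}. g j = 0 \<or> g j > m} \<le> k)"
    unfolding partial_involutions_def mem_Collect_eq using assms(1,2) by blast
  have f: "f \<in> partial_involutions k n \<longleftrightarrow>
      (\<forall>m\<in>{1..n}. card {j \<in> {1..m}. f j = 0 \<or> f j > m} \<le> k)"
    unfolding partial_involutions_def mem_Collect_eq using assms(3,4) by blast
  have "{j \<in> {1..m}. f j = 0 \<or> f j > m} = {j \<in> {1..m}. g j = 0 \<or> g j > m}" if "m \<in> {1..n}" for m
  proof -
    have "f j = 0 \<or> f j > m \<longleftrightarrow> g j = 0 \<or> g j > m" if "j \<in> {1..m}" for j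
      using fg[of j] that \<open>m \<in> {1..n}\<close> by auto
    then show ?thesis
      by blast
  qed
  then have "(\<forall>m\<in>{1..n}. card {j \<in> {1..m}. f j = 0 \<or> f j > m} \<le> k) \<longleftrightarrow>
      (\<forall>m\<in>{1..n}. card {j \<in> {1..m}. g j = 0 \<or> g j > m} \<le> k)"
    by (intro ball_cong refl) (simp only:)
  moreover have "{j \<in> {1..Suc n}. g j = 0 \<or> g j > Suc n} = open_arcs (Suc n) g"
    using assms(2) by (fastforce simp: open_arcs_def)
  then have "(\<forall>m\<in>{1..Suc n}. card {j \<in> {1..m}. g j = 0 \<or> g j > m} \<le> k) \<longleftrightarrow>
      card (open_arcs (Suc n) g) \<le> k \<and>
      (\<forall>m\<in>{1..n}. card {j \<in> {1..m}. g j = 0 \<or> g j > m} \<le> k)"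
    by (simp only: atLeast1_atMost_Suc[of n] ball_simps)
  ultimately show ?thesis
    unfolding f g by blast
qed

lemma fixed_points_Suc:
  "fixed_points (Suc n) f = fixed_points n f + (if f (Suc n) = Suc n then 1 else 0)"
proof -
  have "{i \<in> {1..Suc n}. f i = i} =
      {i \<in> {1..n}. f i = i} \<union> (if f (Suc n) = Suc n then {Suc n} else {})"
    by (auto simp: le_Suc_eq)
  then show ?thesis
    by (simp add: fixed_points_def)
qed

lemma excedances_Suc:
  "excedances (Suc n) f = excedances n f + (if f (Suc n) > Suc n then 1 else 0)"
proof -
  have "{i \<in> {1..Suc n}. f i > i} =
      {i \<in> {1..n}. f i > i} \<union> (if f (Suc n) > Suc n then {Suc n} else {})"
    by (auto simp: le_Suc_eq)
  then show ?thesis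
    by (simp add: excedances_def)
qed

lemma open_arcs_Suc:
  "open_arcs (Suc n) f = open_arcs n f \<union> (if f (Suc n) = 0 then {Suc n} else {})"
  by (auto simp: open_arcs_def le_Suc_eq)

lemma Suc_notin_open_arcs [simp]: "Suc n \<notin> open_arcs n f"
  by (simp add: open_arcs_def)

lemma weight_open:
  "weight (Suc n) (f(Suc n := 0)) = weight n f"
proof -
  have "closed_pairs (Suc n) (f(Suc n := 0)) = closed_pairs n f"
    "open_pairs (Suc n) (f(Suc n := 0)) = open_pairs n f"
    by (auto simp: closed_pairs_def open_pairs_def le_Suc_eq split: if_splits)
  moreover have "fixed_points n (f(Suc n := 0)) = fixed_points n f"
    "excedances n (f(Suc n := 0)) = excedances n f"
    by (auto simp: fixed_points_def excedances_def intro!: arg_cong[where f = card])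
  ultimately show ?thesis
    by (simp add: weight_def partial_inversions_def fixed_points_Suc excedances_Suc)
qed

lemma weight_fixed:
  assumes "f \<in> partial_involutions k n"
  shows "weight (Suc n) f = u * q ^ (2 * card (open_arcs n f)) * weight n f"
proof -
  have S: "f (Suc n) = Suc n"
    using partial_involutionsD(1)[OF assms] by auto
  have le: "f i \<le> n" if "i \<le> n" for i
    using partial_involutions_le[OF assms] that by auto
  have "closed_pairs (Suc n) f = closed_pairs n f"
    using S le by (fastforce simp: closed_pairs_def le_Suc_eq)
  moreover have "open_pairs (Suc n) f = open_pairs n f \<union> open_arcs n f \<times> {Suc n}"
    using S by (auto simp: open_pairs_def open_arcs_def le_Suc_eq)
  moreover have "open_pairs n f \<inter> open_arcs n f \<times> {Suc n} = {}"
    by (auto simp: open_pairs_def)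
  ultimately have "partial_inversions (Suc n) f = partial_inversions n f + 2 * card (open_arcs n f)"
    by (simp add: partial_inversions_def card_Un_disjoint card_cartesian_product)
  then show ?thesis
    using S by (simp add: weight_def fixed_points_Suc excedances_Suc power_add algebra_simps)
qed

definition close_arc :: "nat \<Rightarrow> (nat \<Rightarrow> nat) \<Rightarrow> nat \<Rightarrow> nat \<Rightarrow> nat" where
  "close_arc n f a = f(a := Suc n, Suc n := a)"

lemma partial_inversions_close:
  assumes f: "f \<in> partial_involutions k n" and a: "a \<in> open_arcs n f"
  shows "partial_inversions (Suc n) (close_arc n f a) =
    partial_inversions n f + 1 + 2 * (card (open_arcs n f) - 1)
      + 2 * card {i \<in> open_arcs n f. i < a}"
proof -
  let ?g = "close_arc n f a"
  define R where "R = {j \<in> {1..n}. a < j \<and> 0 < f j}"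
  define R' where "R' = {j \<in> {1..n}. a < f j}"
  define L where "L = {i \<in> open_arcs n f. i < a}"
  define M where "M = open_arcs n f - {a}"
  have fin: "finite R" "finite R'" "finite L" "finite M"
    by (simp_all add: R_def R'_def L_def M_def)
  have a': "1 \<le> a" "a \<le> n" "f a = 0"
    using a by (auto simp: open_arcs_def)
  have le: "f i \<le> n" if "i \<le> n" for i
    using partial_involutions_le[OF f] that by auto
  have ne: "f i \<noteq> a" if "i \<le> n" for i
    using partial_involutionsD(3)[OF f, of i] partial_involutionsD(1)[OF f, of i] that a'
    by (cases "i = 0") auto
  have "bij_betw f R R'"
  proof (rule bij_betwI[where g = f])
    show "f \<in> R \<rightarrow> R'" "f \<in> R' \<rightarrow> R"
      using partial_involutionsD[OF f] ne a' by (auto simp: R_def R'_def Suc_le_eq)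
  qed (use partial_involutionsD[OF f] a' in \<open>auto simp: R_def R'_def\<close>)
  then have RR': "card R' = card R"
    by (simp add: bij_betw_same_card)
  have "(i, j) \<in> closed_pairs (Suc n) ?g \<longleftrightarrow>
      (i, j) \<in> closed_pairs n f \<union> {a} \<times> R \<union> (R' \<union> {a}) \<times> {Suc n}" for i j
  proof (cases "i \<in> {1..n} \<and> j \<in> {1..Suc n} \<and> i < j")
    case True
    then consider "j = Suc n" | "j = a" | "i = a" "j \<le> n" | "i \<noteq> a" "j \<noteq> a" "j \<le> n"
      by fastforce
    then show ?thesis
      using True a' le[of i] le[of j] by cases (auto simp: closed_pairs_def R_def R'_def close_arc_def)
  qed (use a' in \<open>auto simp: closed_pairs_def R_def R'_def close_arc_def\<close>)
  then have "closed_pairs (Suc n) ?g = closed_pairs n f \<union> {a} \<times> R \<union> (R' \<union> {a}) \<times> {Suc n}"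
    by auto
  moreover have "closed_pairs n f \<inter> {a} \<times> R = {}" "a \<notin> R'"
    "(closed_pairs n f \<union> {a} \<times> R) \<inter> (R' \<union> {a}) \<times> {Suc n} = {}"
    using a' by (auto simp: closed_pairs_def R_def R'_def)
  ultimately have A: "card (closed_pairs (Suc n) ?g) = card (closed_pairs n f) + 2 * card R + 1"
    using fin RR' by (simp add: card_Un_disjoint card_cartesian_product)
  have "(i, j) \<in> open_pairs (Suc n) ?g \<union> {a} \<times> R \<longleftrightarrow>
      (i, j) \<in> open_pairs n f \<union> L \<times> {a} \<union> M \<times> {Suc n}" for i j
  proof (cases "i \<in> {1..n} \<and> j \<in> {1..Suc n} \<and> i < j")
    case True
    then consider "j = Suc n" | "j = a" | "i = a" "j \<le> n" | "i \<noteq> a" "j \<noteq> a" "j \<le> n"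
      by fastforce
    then show ?thesis
      using True a' le[of i] le[of j]
      by cases (auto simp: open_pairs_def R_def L_def M_def close_arc_def open_arcs_def)
  qed (use a' in \<open>auto simp: open_pairs_def R_def L_def M_def close_arc_def open_arcs_def\<close>)
  then have eq: "open_pairs (Suc n) ?g \<union> {a} \<times> R = open_pairs n f \<union> L \<times> {a} \<union> M \<times> {Suc n}"
    by (auto simp del: Un_iff)
  have "open_pairs (Suc n) ?g \<inter> {a} \<times> R = {}"
    using a' by (auto simp: open_pairs_def R_def close_arc_def)
  moreover have "open_pairs n f \<inter> L \<times> {a} = {}" "(open_pairs n f \<union> L \<times> {a}) \<inter> M \<times> {Suc n} = {}"
    using a' by (auto simp: open_pairs_def L_def)
  ultimately have "card (open_pairs (Suc n) ?g) + card R = card (open_pairs n f) + card L + card M"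
    using fin arg_cong[OF eq, of card] by (simp add: card_Un_disjoint card_cartesian_product)
  moreover have "card M = card (open_arcs n f) - 1"
    using a by (simp add: M_def)
  ultimately show ?thesis
    using A by (simp add: partial_inversions_def L_def)
qed

lemma weight_close:
  assumes f: "f \<in> open_involutions k n (Suc h)" and a: "a \<in> open_arcs n f"
  shows "weight (Suc n) (close_arc n f a) =
    v * q ^ (2 * h + 1) * q ^ (2 * card {i \<in> open_arcs n f. i < a}) * weight n f"
proof -
  have f': "f \<in> partial_involutions k n" "card (open_arcs n f) = Suc h"
    using f by (auto simp: open_involutions_def)
  have a': "1 \<le> a" "a \<le> n" "f a = 0"
    using a by (auto simp: open_arcs_def)
  have "fixed_points n (close_arc n f a) = fixed_points n f"
    unfolding fixed_points_def close_arc_def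
    using a' by (intro arg_cong[where f = card]) auto
  moreover have "{i \<in> {1..n}. close_arc n f a i > i} = insert a {i \<in> {1..n}. f i > i}"
    using a' by (auto simp: close_arc_def)
  then have "excedances n (close_arc n f a) = excedances n f + 1"
    using a' by (simp add: excedances_def)
  moreover have "close_arc n f a (Suc n) = a"
    by (simp add: close_arc_def)
  ultimately show ?thesis
    using a' f'(2) partial_inversions_close[OF f'(1) a]
    by (simp add: weight_def fixed_points_Suc excedances_Suc power_add algebra_simps)
qed

lemma open_involutions_open:
  assumes "h \<le> k"
  shows "{g \<in> open_involutions k (Suc n) h. g (Suc n) = 0} =
    (if h = 0 then {} else (\<lambda>f. f(Suc n := 0)) ` open_involutions k n (h - 1))"
proof -
  have *: "f(Suc n := 0) \<in> open_involutions k (Suc n) h \<longleftrightarrow> f \<in> open_involutions k n (h - 1)"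
    if f: "\<And>i. i \<notin> {1..n} \<Longrightarrow> f i = i"
      "\<And>i. i \<in> {1..n} \<Longrightarrow> f i \<le> n \<and> (f i \<noteq> 0 \<longrightarrow> f (f i) = i)" "h \<noteq> 0" for f
  proof -
    have "open_arcs (Suc n) (f(Suc n := 0)) = insert (Suc n) (open_arcs n f)"
      unfolding open_arcs_Suc by (auto simp: open_arcs_def)
    moreover have "f(Suc n := 0) \<in> partial_involutions k (Suc n) \<longleftrightarrow>
        f \<in> partial_involutions k n \<and> card (open_arcs (Suc n) (f(Suc n := 0))) \<le> k"
      using f by (intro partial_involutions_Suc_iff) (fastforce simp: le_Suc_eq)+
    ultimately show ?thesis
      using f(3) assms by (auto simp: open_involutions_def)
  qed
  show ?thesis
  proof (intro equalityI subsetI)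
    fix g assume g: "g \<in> {g \<in> open_involutions k (Suc n) h. g (Suc n) = 0}"
    then have g': "g \<in> partial_involutions k (Suc n)" "card (open_arcs (Suc n) g) = h"
      by (auto simp: open_involutions_def)
    have "Suc n \<in> open_arcs (Suc n) g"
      using g by (auto simp: open_arcs_def)
    then have h: "h \<noteq> 0"
      using g'(2) by (metis card_0_eq empty_iff finite_open_arcs)
    have ne: "g i \<noteq> Suc n" if "i \<in> {1..n}" for i
      using partial_involutionsD(3)[OF g'(1), of i] g that by auto
    let ?f = "g(Suc n := Suc n)"
    have g_eq: "?f(Suc n := 0) = g"
      using g by auto
    have "?f i = i" if "i \<notin> {1..n}" for i
      using partial_involutionsD(1)[OF g'(1), of i] that by auto
    moreover have "?f i \<le> n \<and> (?f i \<noteq> 0 \<longrightarrow> ?f (?f i) = i)" if "i \<in> {1..n}" for i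
      using partial_involutionsD(2,3)[OF g'(1), of i] ne[OF that] that by auto
    ultimately have "?f \<in> open_involutions k n (h - 1)"
      using *[of ?f] g g_eq h by auto
    then show "g \<in> (if h = 0 then {} else (\<lambda>f. f(Suc n := 0)) ` open_involutions k n (h - 1))"
      using h g_eq by (auto intro!: image_eqI[of _ _ ?f])
  next
    fix g assume g: "g \<in> (if h = 0 then {} else (\<lambda>f. f(Suc n := 0)) ` open_involutions k n (h - 1))"
    then obtain f where f: "h \<noteq> 0" "f \<in> open_involutions k n (h - 1)" "g = f(Suc n := 0)"
      by (auto split: if_splits)
    then show "g \<in> {g \<in> open_involutions k (Suc n) h. g (Suc n) = 0}"
      using *[of f] by (auto simp: open_involutions_def partial_involutions_def)
  qed
qed

lemma open_involutions_fixed: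
  assumes "h \<le> k"
  shows "{g \<in> open_involutions k (Suc n) h. g (Suc n) = Suc n} = open_involutions k n h"
proof -
  have *: "f \<in> open_involutions k (Suc n) h \<longleftrightarrow> f \<in> open_involutions k n h"
    if f: "\<And>i. i \<notin> {1..n} \<Longrightarrow> f i = i"
      "\<And>i. i \<in> {1..n} \<Longrightarrow> f i \<le> n \<and> (f i \<noteq> 0 \<longrightarrow> f (f i) = i)" for f
  proof -
    have "open_arcs (Suc n) f = open_arcs n f"
      unfolding open_arcs_Suc using f(1)[of "Suc n"] by simp
    moreover have "f \<in> partial_involutions k (Suc n) \<longleftrightarrow>
        f \<in> partial_involutions k n \<and> card (open_arcs (Suc n) f) \<le> k"
      using f by (intro partial_involutions_Suc_iff) (fastforce simp: le_Suc_eq)+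
    ultimately show ?thesis
      using assms by (auto simp: open_involutions_def)
  qed
  show ?thesis
  proof (intro equalityI subsetI)
    fix g assume g: "g \<in> {g \<in> open_involutions k (Suc n) h. g (Suc n) = Suc n}"
    then have g': "g \<in> partial_involutions k (Suc n)"
      by (auto simp: open_involutions_def)
    have ne: "g i \<noteq> Suc n" if "i \<in> {1..n}" for i
      using partial_involutionsD(3)[OF g', of i] g that by auto
    have "g i = i" if "i \<notin> {1..n}" for i
      using partial_involutionsD(1)[OF g', of i] g that by (cases "i = Suc n") auto
    moreover have "g i \<le> n \<and> (g i \<noteq> 0 \<longrightarrow> g (g i) = i)" if "i \<in> {1..n}" for i
      using partial_involutionsD(2,3)[OF g', of i] ne[OF that] that by auto
    ultimately show "g \<in> open_involutions k n h"
      using *[of g] g by auto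
  next
    fix f assume f: "f \<in> open_involutions k n h"
    then show "f \<in> {g \<in> open_involutions k (Suc n) h. g (Suc n) = Suc n}"
      using *[of f] by (auto simp: open_involutions_def partial_involutions_def)
  qed
qed

lemma open_involutions_close:
  assumes "h \<le> k"
  shows "bij_betw (\<lambda>(f, a). close_arc n f a)
    (SIGMA f : open_involutions k n (Suc h). open_arcs n f)
    {g \<in> open_involutions k (Suc n) h. g (Suc n) \<in> {1..n}}"
proof -
  let ?undo = "\<lambda>g::nat \<Rightarrow> nat. (g(g (Suc n) := 0, Suc n := Suc n), g (Suc n))"
  show ?thesis
  proof (rule bij_betwI[where g = ?undo])
    show "(\<lambda>(f, a). close_arc n f a) \<in> (SIGMA f : open_involutions k n (Suc h). open_arcs n f)
      \<rightarrow> {g \<in> open_involutions k (Suc n) h. g (Suc n) \<in> {1..n}}"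
    proof clarify
      fix f a assume f: "f \<in> open_involutions k n (Suc h)" and a: "a \<in> open_arcs n f"
      let ?g = "close_arc n f a"
      have f': "f \<in> partial_involutions k n" "card (open_arcs n f) = Suc h"
        using f by (auto simp: open_involutions_def)
      have a': "1 \<le> a" "a \<le> n" "f a = 0"
        using a by (auto simp: open_arcs_def)
      have ne: "f i \<noteq> a" "f i \<noteq> Suc n" if "i \<in> {1..n}" for i
        using partial_involutionsD[OF f'(1), of i] that a' by auto
      have "open_arcs (Suc n) ?g = open_arcs n f - {a}"
        using a' by (auto simp: open_arcs_def close_arc_def le_Suc_eq)
      then have o: "card (open_arcs (Suc n) ?g) = h"
        using f'(2) a by simp
      have "?g \<in> partial_involutions k (Suc n) \<longleftrightarrow>
          f \<in> partial_involutions k n \<and> card (open_arcs (Suc n) ?g) \<le> k"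
      proof (rule partial_involutions_Suc_iff)
        show "?g i = i" if "i \<notin> {1..Suc n}" for i
          using partial_involutionsD(1)[OF f'(1), of i] that a' by (auto simp: close_arc_def)
        show "?g i \<le> Suc n \<and> (?g i \<noteq> 0 \<longrightarrow> ?g (?g i) = i)" if "i \<in> {1..Suc n}" for i
          using partial_involutionsD(2,3)[OF f'(1), of i] ne[of i] that a'
          by (auto simp: close_arc_def le_Suc_eq)
        show "f i = (if ?g i = Suc n then 0 else ?g i)" if "i \<in> {1..n}" for i
          using ne[OF that] that a' by (auto simp: close_arc_def)
      qed (use partial_involutionsD[OF f'(1)] in auto)
      then show "?g \<in> open_involutions k (Suc n) h \<and> ?g (Suc n) \<in> {1..n}"
        using f'(1) o assms a' by (auto simp: open_involutions_def close_arc_def)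
    qed
    show "?undo \<in> {g \<in> open_involutions k (Suc n) h. g (Suc n) \<in> {1..n}}
      \<rightarrow> (SIGMA f : open_involutions k n (Suc h). open_arcs n f)"
    proof
      fix g assume g: "g \<in> {g \<in> open_involutions k (Suc n) h. g (Suc n) \<in> {1..n}}"
      define a where "a = g (Suc n)"
      let ?f = "g(a := 0, Suc n := Suc n)"
      have g': "g \<in> partial_involutions k (Suc n)" "card (open_arcs (Suc n) g) = h"
        and a: "1 \<le> a" "a \<le> n"
        using g by (auto simp: open_involutions_def a_def)
      have ga: "g a = Suc n"
        using partial_involutionsD(3)[OF g'(1), of "Suc n"] a by (auto simp: a_def)
      have eq: "g i \<noteq> a" "g i \<noteq> Suc n" if "i \<in> {1..n}" "i \<noteq> a" for i
        using partial_involutionsD(3)[OF g'(1), of i] that a ga by (auto simp: a_def)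
      have "g \<in> partial_involutions k (Suc n) \<longleftrightarrow>
          ?f \<in> partial_involutions k n \<and> card (open_arcs (Suc n) g) \<le> k"
      proof (rule partial_involutions_Suc_iff)
        show "?f i = i" if "i \<notin> {1..n}" for i
          using partial_involutionsD(1)[OF g'(1), of i] that a by auto
        show "?f i \<le> n \<and> (?f i \<noteq> 0 \<longrightarrow> ?f (?f i) = i)" if "i \<in> {1..n}" for i
          using partial_involutionsD(2,3)[OF g'(1), of i] eq[of i] that a by auto
        show "?f i = (if g i = Suc n then 0 else g i)" if "i \<in> {1..n}" for i
          using eq[of i] ga that by auto
      qed (use partial_involutionsD[OF g'(1)] in auto)
      moreover have "open_arcs n ?f = insert a (open_arcs (Suc n) g)"
        using a by (auto simp: open_arcs_def a_def le_Suc_eq)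
      moreover have "a \<notin> open_arcs (Suc n) g"
        using ga by (auto simp: open_arcs_def)
      ultimately have "?f \<in> open_involutions k n (Suc h) \<and> a \<in> open_arcs n ?f"
        using g' by (auto simp: open_involutions_def)
      then show "?undo g \<in> (SIGMA f : open_involutions k n (Suc h). open_arcs n f)"
        by (simp add: a_def)
    qed
    show "?undo (case x of (f, a) \<Rightarrow> close_arc n f a) = x"
      if "x \<in> (SIGMA f : open_involutions k n (Suc h). open_arcs n f)" for x
      using that
      by (auto simp: open_arcs_def close_arc_def fun_eq_iff open_involutions_def partial_involutions_def)
    show "(case ?undo g of (f, a) \<Rightarrow> close_arc n f a) = g"
      if "g \<in> {g \<in> open_involutions k (Suc n) h. g (Suc n) \<in> {1..n}}" for g
    proof -
      have "g \<in> partial_involutions k (Suc n)" "g (Suc n) \<in> {1..n}"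
        using that by (auto simp: open_involutions_def)
      then have "g (g (Suc n)) = Suc n"
        using partial_involutionsD(3)[of g k "Suc n" "Suc n"] by auto
      then show ?thesis
        by (auto simp: close_arc_def fun_eq_iff)
    qed
  qed
qed

lemma sum_rank:
  fixes F :: "nat \<Rightarrow> 'b::comm_monoid_add" and A :: "'a::linorder set"
  assumes "finite A"
  shows "(\<Sum>a\<in>A. F (card {i \<in> A. i < a})) = (\<Sum>l<card A. F l)"
  using assms
proof (induction rule: finite_linorder_max_induct)
  case (insert b A)
  have "{i \<in> insert b A. i < a} = {i \<in> A. i < a}" if "a \<in> A" for a
    using insert.hyps that by force+
  moreover have "{i \<in> insert b A. i < b} = A"
    using insert.hyps by force
  moreover have "b \<notin> A"
    using insert.hyps by auto
  ultimately show ?case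
    using insert.hyps insert.IH by (simp add: add.commute)
qed simp

lemma open_weight_Suc:
  assumes "h \<le> k"
  shows "open_weight k (Suc n) h =
    (if h = 0 then 0 else open_weight k n (h - 1)) + u * q ^ (2 * h) * open_weight k n h
      + v * q ^ (2 * h + 1) * (\<Sum>l\<le>h. q ^ (2 * l)) * open_weight k n (Suc h)"
proof -
  let ?I = "open_involutions k (Suc n) h"
  let ?A = "{g \<in> ?I. g (Suc n) = 0}" and ?B = "{g \<in> ?I. g (Suc n) = Suc n}"
    and ?C = "{g \<in> ?I. g (Suc n) \<in> {1..n}}"
  have "g (Suc n) \<le> Suc n" if "g \<in> ?I" for g
    using that by (auto simp: open_involutions_def partial_involutions_def)
  then have "?I = ?A \<union> ?B \<union> ?C"
    by (fastforce simp: le_Suc_eq)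
  moreover have "sum (weight (Suc n)) (?A \<union> ?B \<union> ?C) =
      sum (weight (Suc n)) ?A + sum (weight (Suc n)) ?B + sum (weight (Suc n)) ?C"
    by (subst sum.union_disjoint; auto)+
  moreover have "sum (weight (Suc n)) ?A = (if h = 0 then 0 else open_weight k n (h - 1))"
  proof -
    have "inj_on (\<lambda>f. f(Suc n := 0)) (open_involutions k n (h - 1))"
    proof (rule inj_onI)
      fix f g assume "f \<in> open_involutions k n (h - 1)" "g \<in> open_involutions k n (h - 1)"
        and eq: "f(Suc n := 0) = g(Suc n := 0)"
      then have "f (Suc n) = g (Suc n)"
        by (simp add: open_involutions_def partial_involutions_def)
      then show "f = g"
        using eq by (metis fun_upd_triv fun_upd_upd)
    qed
    then show ?thesis
      by (simp add: open_involutions_open[OF assms] sum.reindex weight_open open_weight_def)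
  qed
  moreover have "sum (weight (Suc n)) ?B = u * q ^ (2 * h) * open_weight k n h"
    unfolding open_involutions_fixed[OF assms] open_weight_def sum_distrib_left
    by (rule sum.cong) (auto simp: open_involutions_def weight_fixed)
  moreover have "sum (weight (Suc n)) ?C =
      v * q ^ (2 * h + 1) * (\<Sum>l\<le>h. q ^ (2 * l)) * open_weight k n (Suc h)"
  proof -
    have "sum (weight (Suc n)) ?C =
        (\<Sum>(f, a)\<in>(SIGMA f : open_involutions k n (Suc h). open_arcs n f).
          weight (Suc n) (close_arc n f a))"
      using sum.reindex_bij_betw[OF open_involutions_close[OF assms], of "weight (Suc n)"]
      by (simp add: case_prod_unfold)
    also have "\<dots> = (\<Sum>f\<in>open_involutions k n (Suc h). \<Sum>a\<in>open_arcs n f.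
        weight (Suc n) (close_arc n f a))"
      by (simp add: sum.Sigma)
    also have "\<dots> = (\<Sum>f\<in>open_involutions k n (Suc h).
        v * q ^ (2 * h + 1) * (\<Sum>l\<le>h. q ^ (2 * l)) * weight n f)"
    proof (rule sum.cong[OF refl])
      fix f assume f: "f \<in> open_involutions k n (Suc h)"
      have "(\<Sum>a\<in>open_arcs n f. weight (Suc n) (close_arc n f a)) =
          v * q ^ (2 * h + 1) * (\<Sum>a\<in>open_arcs n f. q ^ (2 * card {i \<in> open_arcs n f. i < a}))
            * weight n f"
        unfolding sum_distrib_left sum_distrib_right by (intro sum.cong refl weight_close[OF f])
      also have "(\<Sum>a\<in>open_arcs n f. q ^ (2 * card {i \<in> open_arcs n f. i < a})) =
          (\<Sum>l\<le>h. q ^ (2 * l))"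
        using f sum_rank[OF finite_open_arcs, of "\<lambda>l. q ^ (2 * l)" n f]
        by (simp add: open_involutions_def lessThan_Suc_atMost)
      finally show "(\<Sum>a\<in>open_arcs n f. weight (Suc n) (close_arc n f a)) =
        v * q ^ (2 * h + 1) * (\<Sum>l\<le>h. q ^ (2 * l)) * weight n f" .
    qed
    finally show ?thesis
      by (simp add: open_weight_def sum_distrib_left)
  qed
  ultimately show ?thesis
    by (simp add: open_weight_def)
qed

subsection \<open>The continued fraction\<close>

definition open_gf :: "nat \<Rightarrow> nat \<Rightarrow> coeff_ring fps" where
  "open_gf k h = Abs_fps (\<lambda>n. open_weight k n h)"

lemma open_gf_eq:
  assumes "h \<le> k"
  shows "open_gf k h = (if h = 0 then 1 else fps_X * open_gf k (h - 1))
    + fps_const (u * q ^ (2 * h)) * fps_X * open_gf k h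
    + fps_const (v * q ^ (2 * h + 1) * (\<Sum>l\<le>h. q ^ (2 * l))) * fps_X * open_gf k (Suc h)"
proof (rule fps_ext)
  fix n
  show "fps_nth (open_gf k h) n = fps_nth ((if h = 0 then 1 else fps_X * open_gf k (h - 1))
    + fps_const (u * q ^ (2 * h)) * fps_X * open_gf k h
    + fps_const (v * q ^ (2 * h + 1) * (\<Sum>l\<le>h. q ^ (2 * l))) * fps_X * open_gf k (Suc h)) n"
    by (cases n) (simp_all add: open_gf_def open_weight_0 open_weight_Suc[OF assms] mult.assoc)
qed

lemma cf_denom_open_gf:
  assumes "h \<le> k"
  shows "cf_denom k h * open_gf k h = (if h = 0 then 1 else fps_X * open_gf k (h - 1))"
proof -
  have diff: "x - b - c = r" if "x = r + b + c" for x r b c :: "coeff_ring fps"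
    using that by simp
  show ?thesis
    using assms
  proof (induction h rule: inc_induct)
    case base
    have "open_gf k (Suc k) = 0"
      by (simp add: open_gf_def open_weight_eq_0 fps_eq_iff)
    then show ?case
      using diff[OF open_gf_eq[of k k]] by (subst cf_denom.simps) (simp add: left_diff_distrib)
  next
    case (step h)
    let ?r = "fps_recip (cf_denom k (Suc h))"
    let ?c = "fps_const (v * q ^ (2 * h + 1) * (\<Sum>l\<le>h. q ^ (2 * l)))"
    let ?b = "fps_const (u * q ^ (2 * h))"
    have "open_gf k (Suc h) = (cf_denom k (Suc h) * ?r) * open_gf k (Suc h)"
      by (simp only: fps_recip[OF cf_denom_nth_0] mult_1_left)
    also have "\<dots> = ?r * (cf_denom k (Suc h) * open_gf k (Suc h))"
      by (simp only: ac_simps)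
    also have "\<dots> = ?r * (fps_X * open_gf k h)"
      by (simp add: step.IH)
    finally have S: "open_gf k (Suc h) = ?r * (fps_X * open_gf k h)" .
    have "cf_denom k h * open_gf k h =
        open_gf k h - ?b * fps_X * open_gf k h - ?c * fps_X * (?r * (fps_X * open_gf k h))"
      using step.hyps
      by (subst cf_denom.simps)
        (simp add: left_diff_distrib right_diff_distrib power2_eq_square ac_simps)
    also have "\<dots> = (if h = 0 then 1 else fps_X * open_gf k (h - 1))"
      using diff[OF open_gf_eq[of h k]] step.hyps unfolding S by simp
    finally show ?case .
  qed
qed

lemma open_involutions_0: "open_involutions k n 0 = bounded_involutions k n"
proof (intro equalityI subsetI)
  fix f assume "f \<in> open_involutions k n 0"
  then have f: "f \<in> partial_involutions k n" and "open_arcs n f = {}"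
    by (auto simp: open_involutions_def)
  then have nz: "f i \<noteq> 0" if "i \<in> {1..n}" for i
    using that by (auto simp: open_arcs_def)
  have ff: "f (f i) = i" for i
    using partial_involutionsD(1,3)[OF f] nz by (cases "i \<in> {1..n}") auto
  then have "f permutes {1..n}"
    using partial_involutionsD(1)[OF f] unfolding permutes_def by metis
  moreover have "f = inv f"
    using ff by (metis inv_unique_comp comp_def id_apply fun_eq_iff)
  moreover have "card {j \<in> {1..n}. j \<le> m \<and> f j > m} \<le> k" if "m \<in> {1..n}" for m
  proof -
    have "{j \<in> {1..n}. j \<le> m \<and> f j > m} = {j \<in> {1..m}. f j = 0 \<or> f j > m}"
      using that nz by fastforce
    then show ?thesis
      using f that by (auto simp: partial_involutions_def)
  qed
  ultimately show "f \<in> bounded_involutions k n"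
    by (simp add: bounded_involutions_def bounded_perms_def)
next
  fix f assume "f \<in> bounded_involutions k n"
  then have f: "f permutes {1..n}" "f = inv f"
    "\<And>i. i \<in> {1..n} \<Longrightarrow> card {j \<in> {1..n}. j \<le> i \<and> f j > i} \<le> k"
    by (auto simp: bounded_involutions_def bounded_perms_def)
  have ff: "f (f i) = i" for i
    using permutes_inverses(2)[OF f(1)] f(2) by metis
  have nz: "f i \<in> {1..n}" if "i \<in> {1..n}" for i
    using permutes_in_image[OF f(1)] that by blast
  have "card {j \<in> {1..m}. f j = 0 \<or> f j > m} \<le> k" if "m \<in> {1..n}" for m
  proof -
    have "{j \<in> {1..n}. j \<le> m \<and> f j > m} = {j \<in> {1..m}. f j = 0 \<or> f j > m}"
      using that nz by fastforce
    then show ?thesis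
      using f(3)[OF that] by simp
  qed
  moreover have "open_arcs n f = {}"
    using nz by (fastforce simp: open_arcs_def)
  ultimately show "f \<in> open_involutions k n 0"
    using nz ff permutes_not_in[OF f(1)]
    by (auto simp: open_involutions_def partial_involutions_def)
qed

lemma partial_inversions_eq_inversions:
  assumes "f \<in> bounded_involutions k n"
  shows "partial_inversions n f = inversions n f"
proof -
  have "f permutes {1..n}"
    using assms by (simp add: bounded_involutions_def bounded_perms_def)
  then have nz: "f i > 0" if "i \<in> {1..n}" for i
    using permutes_in_image[of f "{1..n}" i] that by auto
  have "open_pairs n f = {}"
    using nz by (fastforce simp: open_pairs_def)
  moreover have "closed_pairs n f = {(i, j). i \<in> {1..n} \<and> j \<in> {1..n} \<and> i < j \<and> f i > f j}"
    using nz by (auto simp: closed_pairs_def)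
  ultimately show ?thesis
    by (simp add: partial_inversions_def inversions_def)
qed

lemma involution_gf_eq_open_gf: "involution_gf k = open_gf k 0"
proof -
  have "fps_nth (involution_gf k) n = open_weight k n 0" for n
  proof (intro poly_eqI)
    fix r i j
    let ?I = "bounded_involutions k n"
    have "poly.coeff (poly.coeff (poly.coeff (weight n f) r) i) j =
        (if inversions n f = r \<and> fixed_points n f = i \<and> excedances n f = j then 1 else 0)"
      if "f \<in> ?I" for f
      using monomial_eq[of 1 "inversions n f" "fixed_points n f" "excedances n f"]
      by (auto simp: weight_def partial_inversions_eq_inversions[OF that])
    then have "poly.coeff (poly.coeff (poly.coeff (open_weight k n 0) r) i) j =
        (\<Sum>f\<in>?I. if inversions n f = r \<and> fixed_points n f = i \<and> excedances n f = j then 1 else 0)"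
      by (simp add: open_weight_def open_involutions_0 coeff_sum)
    also have "\<dots> = int (card {f \<in> ?I. inversions n f = r \<and> fixed_points n f = i \<and> excedances n f = j})"
      by (simp add: finite_bounded_involutions sum.If_cases Int_def)
    finally show "poly.coeff (poly.coeff (poly.coeff (fps_nth (involution_gf k) n) r) i) j =
        poly.coeff (poly.coeff (poly.coeff (open_weight k n 0) r) i) j"
      by (simp add: involution_gf_nth)
  qed
  then show ?thesis
    by (simp add: fps_eq_iff open_gf_def)
qed

theorem corollary6p3:
  fixes k :: nat
  shows "involution_gf k = fps_recip (cf_denom k 0)"
proof -
  let ?C = "cf_denom k 0"
  have "open_gf k 0 = open_gf k 0 * (?C * fps_recip ?C)"
    by (simp add: fps_recip[OF cf_denom_nth_0])
  also have "\<dots> = (?C * open_gf k 0) * fps_recip ?C"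
    by (simp add: ac_simps)
  also have "\<dots> = fps_recip ?C"
    by (simp add: cf_denom_open_gf)
  finally show ?thesis
    by (simp add: involution_gf_eq_open_gf)
qed

end
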